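(* Let $G$ be a group that acts on a connected graph $X$ such that the sets of orbits of vertices and of edges are finite, and let $Y=X/G$ be the quotient graph (a connected finite graph). Let $T$ be a maximal tree in $Y$ and choose a lift $\widetilde{T}$ of $T$ in $X$. Let $v_1,\dots,v_n$ be the vertices of $T$ and let $\widetilde{v}_1,\dots,\widetilde{v}_n$ be the lifts of $v_1,\dots,v_n$ in $\widetilde{T}$, respectively. Assume that the following conditions hold. (i) Suppose, for some $1\le i\le n$, there exists $k_i\ge 1$ such that there are $k_i$ loops at the vertex $v_i$, and each of these loops has a lift in $X$ at $\widetilde{v}_i$ that is not a loop. Let $\{\xi_j^i\}_{1\le j\le k_i}$ be the set of loops at $v_i$, and denote by $\widetilde{\xi}_j^i$ a lift of $\xi_j^i$ at the vertex $\widetilde{v}_i$ that is not a loop. For each such $i$ and each $1\le j\le k_i$, suppose there exists $\mathfrak{f}_j^i\in G$ such that $\mathfrak{f}_j^i\widetilde{v}_i$ is the other vertex of $\widetilde{\xi}_j^i$ (if there is no such loop at $v_i$ for some $i$, then there is no $\mathfrak{f}_j^i$). (ii) Suppose, for some $l\ge 1$, there exist edges $\xi_1,\dots,\xi_l$ of $Y$ (all the edges of this kind) which are neither loops nor part of $T$. For $1\le m\le l$, let $\widetilde{\xi}_m$ be a lift of $\xi_m$ in $X$ such that exactly one vertex of $\widetilde{\xi}_m$ belongs to the set of vertices of $\widetilde{T}$. If the set of vertices of $\xi_m$ is $\{v_i,v_j\}$ and the set of vertices of $\widetilde{\xi}_m$ is $\{\widetilde{v}_i,\widetilde{w}\}$,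 then there exists $\mathfrak{f}_m\in G$ such that $\mathfrak{f}_m\widetilde{w}=\widetilde{v}_j$ (if there is no non-loop edge outside $T$ in $Y$, then there is no $\mathfrak{f}_m$). For $1\le i\le n$, let $G_i$ be the stabilizer in $G$ of the vertex $\widetilde{v}_i$. Then $$G=\left\langle \bigcup_{i=1}^n\left(G_i\cup\{\mathfrak{f}_j^i:1\le j\le k_i\}\right)\cup\{\mathfrak{f}_m:1\le m\le l\}\right\rangle.$$ In particular, if the groups $G_i$ are finitely generated, then $G$ is also finitely generated.
   Context: The action of $G$ on $X$ is by graph automorphisms. The vertices and edges of the quotient graph $Y=X/G$ are the $G$-orbits of vertices and edges of $X$; an edge of $X$ whose two endpoints lie in the same $G$-orbit becomes a loop in $Y$. A lift of a subgraph of $Y$ is a subgraph of $X$ mapped isomorphically onto it by the quotient map; a lift of an edge of $Y$ is an edge of $X$ in the corresponding orbit. *)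

theory Defs
  imports "HOL-Algebra.Group_Action" "HOL-Algebra.Generated_Groups"
begin

text \<open>Undirected multigraphs; loops and parallel edges are allowed.  The incidence map sends
  an edge to its set of endpoints, which is a singleton exactly when the edge is a loop.\<close>

record ('v, 'e) ugraph =
  verts :: "'v set"
  edges :: "'e set"
  ends :: "'e \<Rightarrow> 'v set"

definition wf_graph :: "('v, 'e) ugraph \<Rightarrow> bool" where
  "wf_graph K \<longleftrightarrow> (\<forall>e\<in>edges K. \<exists>u\<in>verts K. \<exists>w\<in>verts K. ends K e = {u, w})"

definition is_loop :: "('v, 'e) ugraph \<Rightarrow> 'e \<Rightarrow> bool" where
  "is_loop K e \<longleftrightarrow> (\<exists>u. ends K e = {u})"

definition graph_connected :: "('v, 'e) ugraph \<Rightarrow> bool" where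
  "graph_connected K \<longleftrightarrow> verts K \<noteq> {} \<and>
     (\<forall>u\<in>verts K. \<forall>w\<in>verts K. (u, w) \<in> {(x, y). \<exists>e\<in>edges K. ends K e = {x, y}}\<^sup>*)"

text \<open>Loops are the cycles of length one, and two parallel edges form a cycle of length two.\<close>

definition is_cycle :: "('v, 'e) ugraph \<Rightarrow> 'v list \<Rightarrow> 'e list \<Rightarrow> bool" where
  "is_cycle K vs es \<longleftrightarrow> vs \<noteq> [] \<and> length es = length vs \<and> distinct vs \<and> distinct es \<and>
     set vs \<subseteq> verts K \<and> set es \<subseteq> edges K \<and>
     (\<forall>i<length vs. ends K (es ! i) = {vs ! i, vs ! ((i + 1) mod length vs)})"

definition is_tree :: "('v, 'e) ugraph \<Rightarrow> bool" where
  "is_tree K \<longleftrightarrow> wf_graph K \<and> graph_connected K \<and> (\<nexists>vs es. is_cycle K vs es)"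

text \<open>Incidence maps are compared on the edges only, so that their values elsewhere are irrelevant.\<close>

definition subgraph_of :: "('v, 'e) ugraph \<Rightarrow> ('v, 'e) ugraph \<Rightarrow> bool" where
  "subgraph_of H K \<longleftrightarrow> wf_graph H \<and> verts H \<subseteq> verts K \<and> edges H \<subseteq> edges K \<and>
     (\<forall>e\<in>edges H. ends H e = ends K e)"

definition maximal_tree :: "('v, 'e) ugraph \<Rightarrow> ('v, 'e) ugraph \<Rightarrow> bool" where
  "maximal_tree T K \<longleftrightarrow> is_tree T \<and> subgraph_of T K \<and>
     (\<forall>T'. is_tree T' \<and> subgraph_of T' K \<and> subgraph_of T T' \<longrightarrow> subgraph_of T' T)"

definition graph_iso ::
  "('v \<Rightarrow> 'w) \<Rightarrow> ('e \<Rightarrow> 'f) \<Rightarrow> ('v, 'e) ugraph \<Rightarrow> ('w, 'f) ugraph \<Rightarrow> bool" where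
  "graph_iso p q H K \<longleftrightarrow> bij_betw p (verts H) (verts K) \<and> bij_betw q (edges H) (edges K) \<and>
     (\<forall>e\<in>edges H. ends K (q e) = p ` ends H e)"

text \<open>No condition excludes inversions: a group element may fix an edge and swap its endpoints.\<close>

locale graph_action =
  on_verts: group_action G "verts X" \<phi> + on_edges: group_action G "edges X" \<psi>
  for G (structure) and X :: "('v, 'e) ugraph" and \<phi> and \<psi> +
  assumes wf: "wf_graph X"
    and ends_action: "\<lbrakk>g \<in> carrier G; e \<in> edges X\<rbrakk> \<Longrightarrow> ends X (\<psi> g e) = \<phi> g ` ends X e"

text \<open>All edges in one orbit have the same set of endpoint orbits, so the union below is the set
  of orbits of the endpoints of any one representative.\<close>

definition quotient_graph ::
  "('g, 'm) monoid_scheme \<Rightarrow> ('v, 'e) ugraph \<Rightarrow> ('g \<Rightarrow> 'v \<Rightarrow> 'v) \<Rightarrow> ('g \<Rightarrow> 'e \<Rightarrow> 'e)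
    \<Rightarrow> ('v set, 'e set) ugraph" where
  "quotient_graph G X \<phi> \<psi> =
     \<lparr>verts = orbits G (verts X) \<phi>, edges = orbits G (edges X) \<psi>,
      ends = (\<lambda>\<xi>. \<Union>e\<in>\<xi>. orbit G \<phi> ` ends X e)\<rparr>"

definition is_lift ::
  "('g, 'm) monoid_scheme \<Rightarrow> ('v, 'e) ugraph \<Rightarrow> ('g \<Rightarrow> 'v \<Rightarrow> 'v) \<Rightarrow> ('g \<Rightarrow> 'e \<Rightarrow> 'e)
    \<Rightarrow> ('v, 'e) ugraph \<Rightarrow> ('v set, 'e set) ugraph \<Rightarrow> bool" where
  "is_lift G X \<phi> \<psi> H K \<longleftrightarrow> subgraph_of H X \<and> graph_iso (orbit G \<phi>) (orbit G \<psi>) H K"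

definition finitely_generated :: "('g, 'm) monoid_scheme \<Rightarrow> bool" where
  "finitely_generated G \<longleftrightarrow> (\<exists>S. finite S \<and> S \<subseteq> carrier G \<and> generate G S = carrier G)"

text \<open>An edge of the quotient graph is an orbit, so its lifts are exactly its elements.  Since the
  action preserves loops, an orbit consists of loops only or contains none.\<close>

definition unfolded_loops ::
  "('g, 'm) monoid_scheme \<Rightarrow> ('v, 'e) ugraph \<Rightarrow> ('g \<Rightarrow> 'v \<Rightarrow> 'v) \<Rightarrow> ('g \<Rightarrow> 'e \<Rightarrow> 'e)
    \<Rightarrow> 'v \<Rightarrow> 'e set set" where
  "unfolded_loops G X \<phi> \<psi> x =
     {\<xi> \<in> edges (quotient_graph G X \<phi> \<psi>).
        ends (quotient_graph G X \<phi> \<psi>) \<xi> = {orbit G \<phi> x} \<and>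
        (\<exists>e\<in>\<xi>. x \<in> ends X e \<and> \<not> is_loop X e)}"

end

theory Submission
  imports Defs
begin

text \<open>
  Let \<open>H\<close> be the subgroup generated by the stabilizers and the chosen elements, and let \<open>S\<close> be the
  vertex set of the lifted tree.  A maximal tree of a connected graph spans it, so \<open>S\<close> meets every
  vertex orbit exactly once.  Since \<open>H\<close> contains the stabilizer of each point of \<open>S\<close>, the equality
  \<open>H = G\<close> amounts to saying that the \<open>H\<close>-translates of \<open>S\<close> exhaust the vertices of \<open>X\<close>: if
  \<open>g s = k t\<close> with \<open>k \<in> H\<close> and \<open>s, t \<in> S\<close>, then \<open>s = t\<close> because they share an orbit, and
  \<open>k\<^sup>-\<^sup>1 g\<close> fixes \<open>s\<close>.

  As \<open>X\<close> is connected, it suffices that the set \<open>H S\<close> is closed under adjacency, and after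
  translation only edges \<open>e\<close> with an endpoint in \<open>S\<close> matter.  The same stabilizer argument reduces
  this to one representative of each edge orbit: if some edge \<open>g e\<close> has both endpoints in \<open>H S\<close>,
  then \<open>g\<close> lies in \<open>H\<close> and \<open>e\<close> has both endpoints in \<open>H S\<close> as well
  (lemma \<open>subgroup_eq_carrier_if_edge_representatives\<close>).  Such representatives are at hand for every
  kind of edge: an edge of the lifted tree has its endpoints in \<open>S\<close>, and so does a loop of \<open>X\<close> at a
  point of \<open>S\<close>; the chosen lift of a loop of \<open>Y\<close> that unfolds in \<open>X\<close> joins a point \<open>s\<close> of \<open>S\<close> to
  \<open>f s\<close>; and the chosen lift of any other edge joins a point of \<open>S\<close> to some \<open>w\<close> with \<open>h w \<in> S\<close>.
  The elements \<open>f\<close> and \<open>h\<close> belong to \<open>H\<close> by definition.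
\<close>

section \<open>Connectedness and maximal trees\<close>

lemma wf_graph_ends_subset:
  assumes "wf_graph K" and "e \<in> edges K"
  shows "ends K e \<subseteq> verts K"
proof -
  obtain u w where "u \<in> verts K" "w \<in> verts K" "ends K e = {u, w}"
    using assms unfolding wf_graph_def by blast
  then show ?thesis by simp
qed

lemma graph_connected_subset_closed:
  assumes "graph_connected K" and "a \<in> verts K" and "a \<in> A"
    and closed: "\<And>e x y. \<lbrakk>e \<in> edges K; ends K e = {x, y}; x \<in> A\<rbrakk> \<Longrightarrow> y \<in> A"
  shows "verts K \<subseteq> A"
proof
  fix b assume "b \<in> verts K"
  then have "(a, b) \<in> {(x, y). \<exists>e\<in>edges K. ends K e = {x, y}}\<^sup>*"
    using assms(1,2) unfolding graph_connected_def by blast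
  then show "b \<in> A"
    by (induction rule: rtrancl_induct) (use \<open>a \<in> A\<close> closed in auto)
qed

text \<open>A cycle through the new vertex would have to enter and leave it by two different edges, but
  only the new edge ends there; a cycle avoiding the new vertex is already a cycle of the tree.\<close>

lemma is_tree_add_pendant_edge:
  fixes T K :: "('v, 'e) ugraph"
  assumes tree: "is_tree T" and sub: "subgraph_of T K"
    and e: "e \<in> edges K" "ends K e = {a, b}" and a: "a \<in> verts T" and b: "b \<notin> verts T"
  shows "is_tree \<lparr>verts = insert b (verts T), edges = insert e (edges T), ends = ends K\<rparr>"
    (is "is_tree ?T")
proof -
  have endsT: "ends K d = ends T d" if "d \<in> edges T" for d
    using that sub unfolding subgraph_of_def by simp
  have wfT: "ends T d \<subseteq> verts T" if "d \<in> edges T" for d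
    using wf_graph_ends_subset[OF _ that] tree unfolding is_tree_def by simp
  have "\<exists>u\<in>insert b (verts T). \<exists>w\<in>insert b (verts T). ends K d = {u, w}"
    if d: "d \<in> insert e (edges T)" for d
  proof (cases "d = e")
    case True
    then show ?thesis using e a by blast
  next
    case False
    then obtain u w where "u \<in> verts T" "w \<in> verts T" "ends T d = {u, w}"
      using d tree unfolding is_tree_def wf_graph_def by blast
    then show ?thesis using False d endsT by auto
  qed
  then have "wf_graph ?T" unfolding wf_graph_def by simp
  moreover have "graph_connected ?T"
  proof -
    let ?R = "{(x, y). \<exists>d\<in>edges T. ends T d = {x, y}}"
    let ?R' = "{(x, y). \<exists>d\<in>edges ?T. ends ?T d = {x, y}}"
    have "?R \<subseteq> ?R'" using endsT by auto
    then have mono: "?R\<^sup>* \<subseteq> ?R'\<^sup>*" by (rule rtrancl_mono)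
    have "(a, b) \<in> ?R'" "(b, a) \<in> ?R'" using e by auto
    moreover have "(a, u) \<in> ?R'\<^sup>* \<and> (u, a) \<in> ?R'\<^sup>*" if "u \<in> verts T" for u
      using that tree a mono unfolding is_tree_def graph_connected_def by blast
    ultimately have "(a, u) \<in> ?R'\<^sup>* \<and> (u, a) \<in> ?R'\<^sup>*" if "u \<in> verts ?T" for u
      using that by auto
    then have "(u, w) \<in> ?R'\<^sup>*" if "u \<in> verts ?T" "w \<in> verts ?T" for u w
      using that by (meson rtrancl_trans)
    then show ?thesis unfolding graph_connected_def by simp
  qed
  moreover have False if cyc: "is_cycle ?T vs es" for vs es
  proof -
    have len: "length es = length vs" and "distinct es" and "distinct vs" and "vs \<noteq> []"
      and vsub: "set vs \<subseteq> insert b (verts T)" and esub: "set es \<subseteq> insert e (edges T)"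
      and ends: "\<And>i. i < length vs \<Longrightarrow>
        ends K (es ! i) = {vs ! i, vs ! ((i + 1) mod length vs)}"
      using cyc unfolding is_cycle_def by auto
    have at_b: "es ! i = e" if "i < length vs" "b \<in> ends K (es ! i)" for i
    proof -
      have "es ! i \<in> insert e (edges T)" using esub len that(1) by (metis nth_mem subsetD)
      moreover have "es ! i \<notin> edges T" using that(2) endsT[of "es ! i"] wfT[of "es ! i"] b by auto
      ultimately show ?thesis by simp
    qed
    show False
    proof (cases "b \<in> set vs")
      case True
      then obtain i where i: "i < length vs" "vs ! i = b" by (auto simp: in_set_conv_nth)
      \<comment> \<open>\<open>j\<close> is the cyclic predecessor of \<open>i\<close>; it equals \<open>i\<close> only in a cycle of length one\<close>
      define j where "j = (if i = 0 then length vs - 1 else i - 1)"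
      have j: "j < length vs" "(j + 1) mod length vs = i"
        using i \<open>vs \<noteq> []\<close> unfolding j_def by auto
      have "es ! i = e" using at_b ends i by simp
      moreover have "es ! j = e" using at_b ends i j by simp
      ultimately have "i = j" using \<open>distinct es\<close> len i j by (metis nth_eq_iff_index_eq)
      then have "ends K e = {b}" using ends[OF i(1)] \<open>es ! i = e\<close> i j by simp
      then show False using e a b by auto
    next
      case False
      have "e \<notin> set es"
      proof
        assume "e \<in> set es"
        then obtain i where i: "i < length vs" "es ! i = e" using len by (auto simp: in_set_conv_nth)
        have "(i + 1) mod length vs < length vs" using \<open>vs \<noteq> []\<close> by simp
        then have "ends K e \<subseteq> set vs" using ends[OF i(1)] i by simp
        then show False using False e by auto
      qed
      then have *: "set es \<subseteq> edges T" using esub by auto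
      have "ends T (es ! i) = {vs ! i, vs ! ((i + 1) mod length vs)}" if "i < length vs" for i
        using ends[OF that] endsT[of "es ! i"] * that len by (metis nth_mem subsetD)
      then have "is_cycle T vs es"
        using * False vsub len \<open>distinct es\<close> \<open>distinct vs\<close> \<open>vs \<noteq> []\<close>
        unfolding is_cycle_def by auto
      then show False using tree unfolding is_tree_def by blast
    qed
  qed
  ultimately show ?thesis unfolding is_tree_def by blast
qed

lemma maximal_tree_neighbour:
  assumes "maximal_tree T K" and "e \<in> edges K" and "ends K e = {a, b}"
    and "a \<in> verts T" and "b \<in> verts K"
  shows "b \<in> verts T"
proof (rule ccontr)
  let ?T = "\<lparr>verts = insert b (verts T), edges = insert e (edges T), ends = ends K\<rparr>"
  assume b: "b \<notin> verts T"
  have T: "is_tree T" "subgraph_of T K" using assms(1) unfolding maximal_tree_def by auto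
  have "is_tree ?T"
    using is_tree_add_pendant_edge[OF T assms(2-4) b] .
  moreover from this have "subgraph_of ?T K"
    using T(2) assms(2,5) unfolding is_tree_def subgraph_of_def by auto
  moreover have "subgraph_of T ?T"
    using T(2) unfolding subgraph_of_def by auto
  ultimately have "subgraph_of ?T T" using assms(1) unfolding maximal_tree_def by blast
  then show False using b unfolding subgraph_of_def by simp
qed

section \<open>Orbits of vertices and edges\<close>

lemma (in group_action) orbit_eq:
  assumes "x \<in> E" and "y \<in> orbit G \<phi> x"
  shows "orbit G \<phi> y = orbit G \<phi> x"
proof -
  have "y \<in> E" using assms element_image unfolding orbit_def by blast
  then show ?thesis
    using disjoint_union[of "orbit G \<phi> y" "orbit G \<phi> x"] assms orbit_refl[of y]
    unfolding orbits_def by blast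
qed

context graph_action
begin

lemmas ends_subset_verts = wf_graph_ends_subset[OF wf]

lemma ends_quotient_orbit:
  assumes "e \<in> edges X"
  shows "ends (quotient_graph G X \<phi> \<psi>) (orbit G \<psi> e) = orbit G \<phi> ` ends X e"
proof -
  have "orbit G \<phi> ` ends X d = orbit G \<phi> ` ends X e" if d: "d \<in> orbit G \<psi> e" for d
  proof -
    obtain g where g: "g \<in> carrier G" "d = \<psi> g e" using d unfolding orbit_def by blast
    have "orbit G \<phi> (\<phi> g x) = orbit G \<phi> x" if "x \<in> ends X e" for x
      using on_verts.orbit_eq[of x "\<phi> g x"] ends_subset_verts[OF assms] that g(1)
      unfolding orbit_def by blast
    then show ?thesis using ends_action[OF g(1) assms] g(2) by (simp add: image_image)
  qed
  then have "(\<Union>d\<in>orbit G \<psi> e. orbit G \<phi> ` ends X d) = (\<Union>d\<in>orbit G \<psi> e. orbit G \<phi> ` ends X e)"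
    by (rule SUP_cong[OF refl])
  moreover have "orbit G \<psi> e \<noteq> {}" using on_edges.orbit_refl[OF assms] by blast
  ultimately show ?thesis unfolding quotient_graph_def by simp
qed

text \<open>The closure property reaches every vertex of \<open>X\<close> even though \<open>T\<close> lives in the quotient: walking
  along an edge of \<open>X\<close> projects to walking along an edge of the quotient, and an edge leaving \<open>T\<close>
  could be added to \<open>T\<close>.\<close>

lemma maximal_tree_spans_quotient:
  assumes "graph_connected X" and T: "maximal_tree T (quotient_graph G X \<phi> \<psi>)"
  shows "verts T = orbits G (verts X) \<phi>"
proof
  let ?Y = "quotient_graph G X \<phi> \<psi>"
  have "verts T \<subseteq> verts ?Y" "verts T \<noteq> {}"
    using T unfolding maximal_tree_def subgraph_of_def is_tree_def graph_connected_def by auto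
  then show sub: "verts T \<subseteq> orbits G (verts X) \<phi>" unfolding quotient_graph_def by simp
  from sub \<open>verts T \<noteq> {}\<close> obtain a where a: "a \<in> verts X" "orbit G \<phi> a \<in> verts T"
    unfolding orbits_def by blast
  have "verts X \<subseteq> {x. orbit G \<phi> x \<in> verts T}"
  proof (rule graph_connected_subset_closed[OF assms(1) a(1)])
    show "a \<in> {x. orbit G \<phi> x \<in> verts T}" using a(2) by simp
    fix e x y
    assume e: "e \<in> edges X" "ends X e = {x, y}" and x: "x \<in> {x. orbit G \<phi> x \<in> verts T}"
    have "orbit G \<psi> e \<in> edges ?Y" "orbit G \<phi> y \<in> verts ?Y"
      using e ends_subset_verts[OF e(1)] unfolding quotient_graph_def orbits_def by auto
    moreover have "ends ?Y (orbit G \<psi> e) = {orbit G \<phi> x, orbit G \<phi> y}"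
      using ends_quotient_orbit[OF e(1)] e(2) by simp
    ultimately show "y \<in> {x. orbit G \<phi> x \<in> verts T}"
      using maximal_tree_neighbour[OF T] x by simp
  qed
  then show "orbits G (verts X) \<phi> \<subseteq> verts T" unfolding orbits_def by auto
qed

section \<open>A criterion for a subgroup to be the whole group\<close>

text \<open>Since \<open>S\<close> meets each orbit at most once, a group element moving a point of \<open>S\<close> into a
  translate \<open>k S\<close> agrees there with \<open>k\<close>, up to the stabilizer of that point.\<close>

lemma mem_subgroup_if_translates_meet:
  assumes H: "subgroup H G" and S: "S \<subseteq> verts X" "inj_on (orbit G \<phi>) S"
    and stab: "(\<Union>s\<in>S. stabilizer G \<phi> s) \<subseteq> H"
    and g: "g \<in> carrier G" and s: "s \<in> S" and meet: "\<phi> g s \<in> (\<Union>k\<in>H. \<phi> k ` S)"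
  shows "g \<in> H"
proof -
  interpret group G using on_verts.group_hom group_hom.axioms(1) by auto
  obtain k t where k: "k \<in> H" and t: "t \<in> S" and eq: "\<phi> g s = \<phi> k t" using meet by blast
  have kG: "k \<in> carrier G" using subgroup.subset[OF H] k by blast
  have "orbit G \<phi> t = orbit G \<phi> (\<phi> g s)" "orbit G \<phi> s = orbit G \<phi> (\<phi> g s)"
    using on_verts.orbit_eq[of t "\<phi> g s"] on_verts.orbit_eq[of s "\<phi> g s"] S(1) s t eq g kG
    unfolding orbit_def by blast+
  then have "t = s" using inj_onD[OF S(2) _ t s] by simp
  then have "\<phi> (inv k \<otimes> g) s = s"
    using on_verts.composition_rule[of s "inv k" g] on_verts.orbit_sym_aux[of k s "\<phi> g s"]
      S(1) s g kG eq by auto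
  then have "inv k \<otimes> g \<in> stabilizer G \<phi> s" using g kG unfolding stabilizer_def by simp
  then have "inv k \<otimes> g \<in> H" using stab s by blast
  then have "k \<otimes> (inv k \<otimes> g) \<in> H" using subgroup.m_closed[OF H k] by blast
  then show ?thesis using g kG by (simp add: m_assoc[symmetric])
qed

text \<open>The hypothesis \<open>rep\<close> asks for one good edge in each orbit only.  It spreads over the
  orbit because the element \<open>g\<close> carrying \<open>e\<close> to the good edge moves a point of \<open>S\<close> into \<open>H S\<close>, hence
  belongs to \<open>H\<close>.\<close>

lemma subgroup_eq_carrier_if_edge_representatives:
  assumes conn: "graph_connected X" and H: "subgroup H G"
    and S: "S \<subseteq> verts X" "S \<noteq> {}" "inj_on (orbit G \<phi>) S"
    and stab: "(\<Union>s\<in>S. stabilizer G \<phi> s) \<subseteq> H"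
    and rep: "\<And>e s. \<lbrakk>e \<in> edges X; s \<in> S; s \<in> ends X e\<rbrakk> \<Longrightarrow>
      \<exists>d\<in>orbit G \<psi> e. ends X d \<subseteq> (\<Union>k\<in>H. \<phi> k ` S)"
  shows "H = carrier G"
proof
  interpret group G using on_verts.group_hom group_hom.axioms(1) by auto
  let ?HS = "\<Union>k\<in>H. \<phi> k ` S"
  show HG: "H \<subseteq> carrier G" using subgroup.subset[OF H] .
  have HS_verts: "?HS \<subseteq> verts X" using HG S(1) on_verts.surj_prop by blast
  have HS_closed: "\<phi> k x \<in> ?HS" if k: "k \<in> H" and x: "x \<in> ?HS" for k x
  proof -
    obtain k' s where k': "k' \<in> H" "s \<in> S" "x = \<phi> k' s" using x by blast
    then have "\<phi> k x = \<phi> (k \<otimes> k') s"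
      using on_verts.composition_rule[of s k k'] k HG S(1) by (metis subsetD)
    then show ?thesis using subgroup.m_closed[OF H k k'(1)] k'(2) by blast
  qed
  have HS_cancel: "x \<in> ?HS" if k: "k \<in> H" and x: "x \<in> verts X" and kx: "\<phi> k x \<in> ?HS" for k x
    using HS_closed[OF subgroup.m_inv_closed[OF H k] kx] on_verts.orbit_sym_aux[of k x] k HG x
    by (metis subsetD)
  \<comment> \<open>the neighbours of the points of \<open>S\<close> itself\<close>
  have nbr: "ends X e \<subseteq> ?HS" if e: "e \<in> edges X" and s: "s \<in> S" "s \<in> ends X e" for e s
  proof -
    obtain g where g: "g \<in> carrier G" and sub: "ends X (\<psi> g e) \<subseteq> ?HS"
      using rep[OF e s] unfolding orbit_def by blast
    have img: "\<phi> g ` ends X e \<subseteq> ?HS" using sub ends_action[OF g e] by simp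
    then have "\<phi> g s \<in> ?HS" using s(2) by blast
    then have "g \<in> H" by (rule mem_subgroup_if_translates_meet[OF H S(1,3) stab g s(1)])
    show ?thesis
    proof
      fix x assume x: "x \<in> ends X e"
      then have "\<phi> g x \<in> ?HS" using img by blast
      then show "x \<in> ?HS" using HS_cancel[OF \<open>g \<in> H\<close>] x ends_subset_verts[OF e] by blast
    qed
  qed
  obtain s where s: "s \<in> S" using S(2) by blast
  have one: "\<phi> \<one> s = s" using on_verts.id_eq_one s S(1) by (metis restrict_apply' subsetD)
  have "\<phi> \<one> s \<in> ?HS" using subgroup.one_closed[OF H] s by blast
  then have s_HS: "s \<in> ?HS" by (simp only: one)
  have "verts X \<subseteq> ?HS"
  proof (rule graph_connected_subset_closed[OF conn])
    show "s \<in> verts X" using s S(1) by blast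
    show "s \<in> ?HS" by (rule s_HS)
    fix e x y assume e: "e \<in> edges X" "ends X e = {x, y}" and "x \<in> ?HS"
    then obtain k t where k: "k \<in> H" and t: "t \<in> S" and x: "x = \<phi> k t" by blast
    have ik: "inv k \<in> H" using subgroup.m_inv_closed[OF H k] .
    have *: "\<psi> (inv k) e \<in> edges X" using on_edges.element_image[of "inv k" e] ik HG e(1) by blast
    have "ends X (\<psi> (inv k) e) = \<phi> (inv k) ` {x, y}" using ends_action[of "inv k" e] ik HG e by auto
    moreover have "\<phi> (inv k) x = t" using on_verts.orbit_sym_aux[of k t x] k HG t S(1) x by blast
    ultimately have "\<phi> (inv k) y \<in> ?HS" using nbr[OF * t] by auto
    then show "y \<in> ?HS" using HS_cancel[OF ik] ends_subset_verts[OF e(1)] e(2) by auto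
  qed
  then have all: "\<phi> g s \<in> ?HS" if "g \<in> carrier G" for g
    using on_verts.element_image[OF that, of s] s S(1) by blast
  show "carrier G \<subseteq> H"
  proof
    fix g assume g: "g \<in> carrier G"
    show "g \<in> H" by (rule mem_subgroup_if_translates_meet[OF H S(1,3) stab g s all[OF g]])
  qed
qed

end

section \<open>Generators from a lifted maximal tree\<close>

lemma (in group) finitely_generated_UN_subgroups:
  assumes "finite I" and sub: "\<And>i. i \<in> I \<Longrightarrow> subgroup (A i) G"
    and fg: "\<And>i. i \<in> I \<Longrightarrow> finitely_generated (G\<lparr>carrier := A i\<rparr>)"
    and F: "finite F" "F \<subseteq> carrier G"
    and gen: "carrier G = generate G ((\<Union>i\<in>I. A i) \<union> F)"
  shows "finitely_generated G"
proof -
  have "\<exists>S. finite S \<and> S \<subseteq> A i \<and> generate G S = A i" if i: "i \<in> I" for i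
    using fg[OF i] generate_consistent[OF _ sub[OF i]] unfolding finitely_generated_def by auto
  then obtain S where S: "\<And>i. i \<in> I \<Longrightarrow> finite (S i) \<and> S i \<subseteq> A i \<and> generate G (S i) = A i"
    by metis
  let ?S = "(\<Union>i\<in>I. S i) \<union> F"
  have "?S \<subseteq> carrier G" using S sub[THEN subgroup.subset] F(2) by blast
  moreover have "A i \<subseteq> generate G ?S" if "i \<in> I" for i
    using mono_generate[of "S i" ?S] S[OF that] that by blast
  then have "(\<Union>i\<in>I. A i) \<union> F \<subseteq> generate G ?S" by (auto intro: generate.incl)
  ultimately have "carrier G \<subseteq> generate G ?S"
    using gen generate_subgroup_incl generate_is_subgroup by metis
  then have "generate G ?S = carrier G" using generate_incl[OF \<open>?S \<subseteq> carrier G\<close>] by blast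
  moreover have "finite ?S" using S F(1) \<open>finite I\<close> by simp
  ultimately show ?thesis
    using \<open>?S \<subseteq> carrier G\<close> unfolding finitely_generated_def by blast
qed

theorem theorem2p1:
  fixes G :: "('g, 'm) monoid_scheme"
    and X :: "('v, 'e) ugraph"
    and \<phi> :: "'g \<Rightarrow> 'v \<Rightarrow> 'v" and \<psi> :: "'g \<Rightarrow> 'e \<Rightarrow> 'e"
    and Y T :: "('v set, 'e set) ugraph" and T' :: "('v, 'e) ugraph"
    and n l :: nat and k :: "nat \<Rightarrow> nat"
    and v :: "nat \<Rightarrow> 'v set" and v' :: "nat \<Rightarrow> 'v"
    and \<xi> :: "nat \<Rightarrow> nat \<Rightarrow> 'e set" and \<xi>' :: "nat \<Rightarrow> nat \<Rightarrow> 'e" and f :: "nat \<Rightarrow> nat \<Rightarrow> 'g"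
    and \<zeta> :: "nat \<Rightarrow> 'e set" and \<zeta>' :: "nat \<Rightarrow> 'e" and h :: "nat \<Rightarrow> 'g"
  assumes action: "graph_action G X \<phi> \<psi>"
    and connected: "graph_connected X"
    and finite_vertex_orbits: "finite (orbits G (verts X) \<phi>)"
    and finite_edge_orbits: "finite (orbits G (edges X) \<psi>)"
    and Y: "Y = quotient_graph G X \<phi> \<psi>"
    and T: "maximal_tree T Y"
    and T_lift: "is_lift G X \<phi> \<psi> T' T"
    and v: "bij_betw v {1..n} (verts T)"
    and v_lift: "\<And>i. i \<in> {1..n} \<Longrightarrow> v' i \<in> verts T' \<and> orbit G \<phi> (v' i) = v i"
    \<comment> \<open>condition (i); \<open>k i = 0\<close> if there is no such loop at \<open>v i\<close>\<close>
    and loops: "\<And>i. i \<in> {1..n} \<Longrightarrow> bij_betw (\<xi> i) {1..k i} (unfolded_loops G X \<phi> \<psi> (v' i))"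
    and loop_lift: "\<And>i j. \<lbrakk>i \<in> {1..n}; j \<in> {1..k i}\<rbrakk> \<Longrightarrow>
          \<xi>' i j \<in> \<xi> i j \<and> v' i \<in> ends X (\<xi>' i j) \<and> \<not> is_loop X (\<xi>' i j)"
    and loop_elt: "\<And>i j. \<lbrakk>i \<in> {1..n}; j \<in> {1..k i}\<rbrakk> \<Longrightarrow>
          f i j \<in> carrier G \<and> ends X (\<xi>' i j) = {v' i, \<phi> (f i j) (v' i)}"
    \<comment> \<open>condition (ii); \<open>l = 0\<close> if there is no non-loop edge outside \<open>T\<close>\<close>
    and nonloops: "bij_betw \<zeta> {1..l} {\<eta> \<in> edges Y. \<not> is_loop Y \<eta> \<and> \<eta> \<notin> edges T}"
    and nonloop_lift: "\<And>m. m \<in> {1..l} \<Longrightarrow>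
          \<zeta>' m \<in> \<zeta> m \<and> (\<exists>!u. u \<in> ends X (\<zeta>' m) \<and> u \<in> verts T')"
    and nonloop_elt_closed: "\<And>m. m \<in> {1..l} \<Longrightarrow> h m \<in> carrier G"
    and nonloop_elt: "\<And>m i j w. \<lbrakk>m \<in> {1..l}; i \<in> {1..n}; j \<in> {1..n};
          ends Y (\<zeta> m) = {v i, v j}; ends X (\<zeta>' m) = {v' i, w}\<rbrakk> \<Longrightarrow> \<phi> (h m) w = v' j"
  shows "carrier G =
           generate G ((\<Union>i\<in>{1..n}. stabilizer G \<phi> (v' i) \<union> {f i j |j. j \<in> {1..k i}})
                       \<union> {h m |m. m \<in> {1..l}})
       \<and> ((\<forall>i\<in>{1..n}. finitely_generated (G\<lparr>carrier := stabilizer G \<phi> (v' i)\<rparr>))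
             \<longrightarrow> finitely_generated G)"
proof -
  interpret graph_action G X \<phi> \<psi> by (rule action)
  interpret group G using on_verts.group_hom group_hom.axioms(1) by auto
  let ?F = "(\<Union>i\<in>{1..n}. {f i j |j. j \<in> {1..k i}}) \<union> {h m |m. m \<in> {1..l}}"
  let ?gens = "(\<Union>i\<in>{1..n}. stabilizer G \<phi> (v' i) \<union> {f i j |j. j \<in> {1..k i}})
                \<union> {h m |m. m \<in> {1..l}}"
  define H where "H = generate G ?gens"
  let ?S = "verts T'"
  define HS where "HS = (\<Union>g\<in>H. \<phi> g ` ?S)"
  have F: "?F \<subseteq> carrier G" "finite ?F"
    using loop_elt nonloop_elt_closed by (auto simp: Setcompr_eq_image)
  have gens_eq: "?gens = (\<Union>i\<in>{1..n}. stabilizer G \<phi> (v' i)) \<union> ?F" by blast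
  have gens: "?gens \<subseteq> carrier G" using F(1) on_verts.stabilizer_subset unfolding gens_eq by blast
  have H: "subgroup H G" using generate_is_subgroup[OF gens] unfolding H_def .
  have HSI: "\<phi> g s \<in> HS" if "g \<in> H" "s \<in> ?S" for g s using that unfolding HS_def by blast

  have S_sub: "?S \<subseteq> verts X" and edges_T': "edges T' \<subseteq> edges X"
    and wfT': "wf_graph T'" and ends_T': "\<And>e. e \<in> edges T' \<Longrightarrow> ends X e = ends T' e"
    using T_lift unfolding is_lift_def subgraph_of_def by auto
  have bij_v: "bij_betw (orbit G \<phi>) ?S (verts T)" and bij_e: "bij_betw (orbit G \<psi>) (edges T') (edges T)"
    using T_lift unfolding is_lift_def graph_iso_def by auto
  have inj: "inj_on (orbit G \<phi>) ?S" using bij_v bij_betw_def by blast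
  have treeT: "is_tree T" using T unfolding maximal_tree_def by auto
  have S_ne: "?S \<noteq> {}"
    using bij_v treeT unfolding is_tree_def graph_connected_def bij_betw_def by auto
  have vertsT: "verts T = orbits G (verts X) \<phi>"
    using maximal_tree_spans_quotient[OF connected] T Y by simp
  have v_ex: "\<exists>i\<in>{1..n}. orbit G \<phi> x = v i" if "x \<in> verts X" for x
  proof -
    have "orbit G \<phi> x \<in> verts T" using vertsT that unfolding orbits_def by blast
    then show ?thesis using v unfolding bij_betw_def by blast
  qed
  \<comment> \<open>the enumeration \<open>v'\<close> exhausts \<open>S\<close>, since \<open>S\<close> has one point in each orbit\<close>
  have S_ex: "\<exists>i\<in>{1..n}. s = v' i" if s: "s \<in> ?S" for s
  proof -
    obtain i where i: "i \<in> {1..n}" "orbit G \<phi> s = v i" using v_ex s S_sub by blast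
    then have "orbit G \<phi> s = orbit G \<phi> (v' i)" using v_lift by simp
    then show ?thesis using inj s v_lift[OF i(1)] i(1) by (metis inj_onD)
  qed
  have stab: "(\<Union>s\<in>?S. stabilizer G \<phi> s) \<subseteq> H"
  proof (rule UN_least)
    fix s assume "s \<in> ?S"
    then obtain i where "i \<in> {1..n}" "s = v' i" using S_ex by blast
    then show "stabilizer G \<phi> s \<subseteq> H" unfolding H_def by (blast intro: generate.incl)
  qed
  have S_HS: "?S \<subseteq> HS"
  proof
    fix s assume s: "s \<in> ?S"
    then have "\<phi> \<one>\<^bsub>G\<^esub> s = s" using on_verts.id_eq_one S_sub by (metis restrict_apply' subsetD)
    then show "s \<in> HS" using HSI[OF subgroup.one_closed[OF H] s] by simp
  qed

  have rep: "\<exists>d\<in>orbit G \<psi> e. ends X d \<subseteq> HS"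
    if e: "e \<in> edges X" and s: "s \<in> ?S" "s \<in> ends X e" for e s
  proof -
    let ?\<xi> = "orbit G \<psi> e"
    have xi: "?\<xi> \<in> edges Y" using e unfolding Y quotient_graph_def orbits_def by auto
    have orbit_edges: "d \<in> edges X" if "d \<in> ?\<xi>" for d
      using that e on_edges.element_image unfolding orbit_def by blast
    have ends_orbit: "ends Y ?\<xi> = orbit G \<phi> ` ends X d" if d: "d \<in> ?\<xi>" for d
      using ends_quotient_orbit[OF orbit_edges[OF d]] on_edges.orbit_eq[OF e d] unfolding Y by simp
    consider (tree) "?\<xi> \<in> edges T" | (loop_in_X) "is_loop Y ?\<xi>" "is_loop X e"
      | (unfolded) "is_loop Y ?\<xi>" "\<not> is_loop X e" | (other) "\<not> is_loop Y ?\<xi>" "?\<xi> \<notin> edges T"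
      by blast
    then show ?thesis
    proof cases
      case tree
      then obtain d where d: "d \<in> edges T'" "orbit G \<psi> d = ?\<xi>"
        using bij_e unfolding bij_betw_def by (metis imageE)
      then have "d \<in> ?\<xi>" using on_edges.orbit_refl[of d] edges_T' by auto
      moreover have "ends X d \<subseteq> ?S"
        using ends_T'[OF d(1)] wf_graph_ends_subset[OF wfT' d(1)] by simp
      ultimately show ?thesis using S_HS by blast
    next
      case loop_in_X
      then have "ends X e = {s}" using s(2) unfolding is_loop_def by auto
      then have "ends X e \<subseteq> HS" using S_HS s(1) by auto
      then show ?thesis using on_edges.orbit_refl[OF e] by blast
    next
      case unfolded
      obtain i where i: "i \<in> {1..n}" "s = v' i" using S_ex[OF s(1)] by blast
      have "ends Y ?\<xi> = {orbit G \<phi> s}"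
        using unfolded(1) ends_orbit[OF on_edges.orbit_refl[OF e]] s(2) unfolding is_loop_def by auto
      then have "?\<xi> \<in> unfolded_loops G X \<phi> \<psi> s"
        using xi unfolded(2) on_edges.orbit_refl[OF e] s(2) unfolding unfolded_loops_def Y by blast
      then obtain j where j: "j \<in> {1..k i}" "?\<xi> = \<xi> i j"
        using loops[OF i(1)] i(2) unfolding bij_betw_def by blast
      have "f i j \<in> H" using i(1) j(1) unfolding H_def by (blast intro: generate.incl)
      then have "ends X (\<xi>' i j) \<subseteq> HS"
        using loop_elt[OF i(1) j(1)] S_HS s(1) i(2) HSI by auto
      then show ?thesis using loop_lift[OF i(1) j(1)] j(2) by blast
    next
      case other
      then obtain m where m: "m \<in> {1..l}" "?\<xi> = \<zeta> m"
        using nonloops xi unfolding bij_betw_def by blast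
      let ?d = "\<zeta>' m"
      have d: "?d \<in> ?\<xi>" using nonloop_lift[OF m(1)] m(2) by simp
      have dX: "?d \<in> edges X" using orbit_edges[OF d] .
      obtain u where u: "u \<in> ends X ?d" "u \<in> ?S" using nonloop_lift[OF m(1)] by metis
      obtain p q where pq: "ends X ?d = {p, q}" using wf dX unfolding wf_graph_def by blast
      then have "ends X ?d = {u, p} \<or> ends X ?d = {u, q}" using u(1) by auto
      then obtain w where w: "ends X ?d = {u, w}" by blast
      \<comment> \<open>\<open>w\<close> lies outside \<open>S\<close>, but its orbit contains some \<open>v' b\<close>, to which \<open>h m\<close> carries it\<close>
      obtain a where a: "a \<in> {1..n}" "u = v' a" using S_ex[OF u(2)] by blast
      have wX: "w \<in> verts X" using ends_subset_verts[OF dX] w by blast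
      obtain b where b: "b \<in> {1..n}" "orbit G \<phi> w = v b" using v_ex[OF wX] by blast
      have "ends Y (\<zeta> m) = {v a, v b}"
        using ends_orbit[OF d] w m(2) a b(2) v_lift[OF a(1)] by simp
      then have hw: "\<phi> (h m) w = v' b" using nonloop_elt m(1) a b(1) w by simp
      have hH: "inv\<^bsub>G\<^esub> (h m) \<in> H" using m(1) unfolding H_def by (blast intro: generate.inv)
      have "w = \<phi> (inv\<^bsub>G\<^esub> (h m)) (v' b)"
        using on_verts.orbit_sym_aux[OF nonloop_elt_closed[OF m(1)] wX hw] by simp
      then have "w \<in> HS" using HSI[OF hH] v_lift[OF b(1)] by simp
      then have "ends X ?d \<subseteq> HS" using w u(2) S_HS by auto
      then show ?thesis using d by blast
    qed
  qed
  have "H = carrier G"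
    using subgroup_eq_carrier_if_edge_representatives[OF connected H S_sub S_ne inj stab]
      rep[unfolded HS_def] by simp
  then have gen: "carrier G = generate G ?gens" unfolding H_def by simp
  have "finitely_generated G"
    if "\<forall>i\<in>{1..n}. finitely_generated (G\<lparr>carrier := stabilizer G \<phi> (v' i)\<rparr>)"
  proof (rule finitely_generated_UN_subgroups)
    show "subgroup (stabilizer G \<phi> (v' i)) G" if "i \<in> {1..n}" for i
      using on_verts.stabilizer_subgroup v_lift[OF that] S_sub by blast
    show "carrier G = generate G ((\<Union>i\<in>{1..n}. stabilizer G \<phi> (v' i)) \<union> ?F)"
      using gen unfolding gens_eq .
  qed (use F that in auto)
  with gen show ?thesis by simp
qed

end
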